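(* Let $r>1$ and let $Z_r=\{(p,\phi)\in Z: 1/r<p<1,\ \phi\in[0,2\pi]\}$. Then every $f\in C_0^\infty(A_{1,r})$ is uniquely determined by the values $\mathcal{D}f(p,\phi)$ known for all $(p,\phi)\in Z_r$; that is, if $f_1,f_2\in C_0^\infty(A_{1,r})$ satisfy $\mathcal{D}f_1(p,\phi)=\mathcal{D}f_2(p,\phi)$ for all $(p,\phi)\in Z_r$, then $f_1=f_2$.
   Context: Functions are real valued. $C_0^\infty(\Omega)$ denotes the smooth functions with compact support contained in the open set $\Omega\subseteq\mathbb{R}^2$, extended by zero to $\mathbb{R}^2$. $A_{r_1,r_2}=\{x\in\mathbb{R}^2: r_1<|x|<r_2\}$. $Z=\mathbb{R}\times S^1$, with $\phi\in S^1$ regarded as an angle modulo $2\pi$. Disc transform. For $q>0$, $D_{q,\phi}$ is the disc of diameter $q$ whose centre has polar coordinates $(q/2,\phi)$ (so its boundary passes through the origin). For $f\in C_0^\infty(\mathbb{R}^2)$ and $p>0$ put $\mathcal{D}_1f(p,\phi)=\iint_{D_{1/p,\phi}}f\,\mathrm{d}A$, and let $\mathcal{D}_1f(0^+,\phi)=\lim_{p\to0^+}\mathcal{D}_1f(p,\phi)$. Define $\mathcal{D}_2f$ on $Z$ by $\mathcal{D}_2f(p,\phi)=\mathcal{D}_1f(p,\phi)$ for $p>0$, $\mathcal{D}_2f(p,\phi)=\mathcal{D}_1f(-p,\phi+\pi)$ for $p<0$, and $\mathcal{D}_2f(0,\phi)=\frac{1}{2}\left(\mathcal{D}_1f(0^+,\phi)+\mathcal{D}_1f(0^+,\phi+\pi)\right)$.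 Let $c(\phi)=\frac{1}{2}\left(\mathcal{D}_1f(0^+,\phi+\pi)-\mathcal{D}_1f(0^+,\phi)\right)$ and $\mathcal{D}f(p,\phi)=\mathcal{D}_2f(p,\phi)+c(\phi)\,\mathrm{sgn}(p)$, with $\mathrm{sgn}(0)=0$. *)

theory Defs
  imports "HOL-Analysis.Analysis"
begin

text \<open>
  All iterated directional derivatives up to order \<open>k\<close> exist and are Frechet differentiable
  (below order \<open>k\<close>) or continuous (at order \<open>k\<close>). On open subsets of a
  Euclidean space this is the class \<open>C\<^sup>k\<close>.
\<close>
primrec C_k_on :: "nat \<Rightarrow> ('a::real_normed_vector \<Rightarrow> 'b::real_normed_vector) \<Rightarrow> 'a set \<Rightarrow> bool" where
  "C_k_on 0 f S \<longleftrightarrow> continuous_on S f"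
| "C_k_on (Suc k) f S \<longleftrightarrow> (\<forall>x\<in>S. f differentiable (at x)) \<and>
     (\<forall>v. C_k_on k (\<lambda>x. frechet_derivative f (at x) v) S)"

definition smooth_on :: "('a::real_normed_vector \<Rightarrow> 'b::real_normed_vector) \<Rightarrow> 'a set \<Rightarrow> bool" where
  "smooth_on f S \<longleftrightarrow> (\<forall>k. C_k_on k f S)"

text \<open>
  The members are total functions; those supported in \<open>\<Omega>\<close> vanish outside it, so they are
  already the extensions by zero. Intended for open \<open>\<Omega>\<close>.
\<close>
definition C0_infty :: "(real^2) set \<Rightarrow> (real^2 \<Rightarrow> real) set" where
  "C0_infty \<Omega> = {f. smooth_on f \<Omega> \<and> compact (closure {x. f x \<noteq> 0}) \<and> closure {x. f x \<noteq> 0} \<subseteq> \<Omega>}"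

definition annulus :: "real \<Rightarrow> real \<Rightarrow> (real^2) set" where
  "annulus r1 r2 = {x. r1 < norm x \<and> norm x < r2}"

definition polar :: "real \<Rightarrow> real \<Rightarrow> real^2" where
  "polar \<rho> \<phi> = vector [\<rho> * cos \<phi>, \<rho> * sin \<phi>]"

definition disc :: "real \<Rightarrow> real \<Rightarrow> (real^2) set" where
  "disc q \<phi> = cball (polar (q/2) \<phi>) (q/2)"

text \<open>Only meaningful for \<open>p > 0\<close>. Whether the disc is closed is immaterial, its boundary being null.\<close>
definition disc_transform1 :: "(real^2 \<Rightarrow> real) \<Rightarrow> real \<Rightarrow> real \<Rightarrow> real" where
  "disc_transform1 f p \<phi> = (LINT x:disc (1/p) \<phi>|lborel. f x)"

definition disc_transform1_0 :: "(real^2 \<Rightarrow> real) \<Rightarrow> real \<Rightarrow> real" where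
  "disc_transform1_0 f \<phi> = Lim (at_right 0) (\<lambda>p. disc_transform1 f p \<phi>)"

definition disc_transform2 :: "(real^2 \<Rightarrow> real) \<Rightarrow> real \<Rightarrow> real \<Rightarrow> real" where
  "disc_transform2 f p \<phi> =
     (if p > 0 then disc_transform1 f p \<phi>
      else if p < 0 then disc_transform1 f (- p) (\<phi> + pi)
      else (disc_transform1_0 f \<phi> + disc_transform1_0 f (\<phi> + pi)) / 2)"

definition jump_correction :: "(real^2 \<Rightarrow> real) \<Rightarrow> real \<Rightarrow> real" where
  "jump_correction f \<phi> = (disc_transform1_0 f (\<phi> + pi) - disc_transform1_0 f \<phi>) / 2"

definition disc_transform :: "(real^2 \<Rightarrow> real) \<Rightarrow> real \<Rightarrow> real \<Rightarrow> real" where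
  "disc_transform f p \<phi> = disc_transform2 f p \<phi> + jump_correction f \<phi> * sgn p"

definition Z_restr :: "real \<Rightarrow> (real \<times> real) set" where
  "Z_restr r = {(p, \<phi>). 1 / r < p \<and> p < 1 \<and> 0 \<le> \<phi> \<and> \<phi> \<le> 2 * pi}"

text \<open>
  The second coordinate of \<open>Z = \<real> \<times> S\<^sup>1\<close> is represented by a real angle; the transform
  descends to the quotient by \<open>2\<pi>\<close>:
\<close>
lemma disc_transform_periodic: "disc_transform f p (\<phi> + 2 * pi) = disc_transform f p \<phi>"
proof -
  have polar: "polar \<rho> (\<psi> + 2 * pi) = polar \<rho> \<psi>" for \<rho> \<psi>
    by (simp add: polar_def)
  have D1: "disc_transform1 f s (\<psi> + 2 * pi) = disc_transform1 f s \<psi>" for s \<psi>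
    by (simp add: disc_transform1_def disc_def polar)
  have D0: "disc_transform1_0 f (\<psi> + 2 * pi) = disc_transform1_0 f \<psi>" for \<psi>
    by (simp add: disc_transform1_0_def D1)
  have *: "\<phi> + 2 * pi + pi = (\<phi> + pi) + 2 * pi"
    by simp
  show ?thesis
    unfolding disc_transform_def disc_transform2_def jump_correction_def * D0 D1 ..
qed

end

theory Submission
  imports Defs
begin

text \<open>
  For \<open>p\<close> just below \<open>1\<close> the disc \<open>D\<^sub>1\<^sub>/\<^sub>p\<close> does not reach the support of \<open>f\<close>, so the
  data there are the jump correction alone. Hence the data determine the correction, and
  for \<open>f = f1 - f2\<close> all integrals over discs of diameter between \<open>1\<close> and \<open>r\<close> through the
  origin vanish (\<open>disc_transform_eq_imp_disc_transform1_eq\<close>).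

  The inversion \<open>x \<mapsto> x / |x|\<^sup>2\<close> turns such a disc into a half-plane at distance \<open>p\<close> from the
  origin. So, transported by the inversion, the signed measure \<open>f dA\<close> lives in the unit disc and
  vanishes on every half-plane that misses the disc of radius \<open>1/r\<close>; the claim is the
  support theorem for the Radon transform on the complement of a disc. Instead of changing
  variables in the integrals, the locale \<open>exterior_null\<close> speaks of an integrable function \<open>f\<close>
  and a map \<open>Y\<close>, here the inversion.

  The support theorem follows from the rotation of half-planes. By approximation with step functions
  the hypothesis gives \<open>\<integral> \<psi> (\<xi> \<bullet> Y) f = 0\<close> for all continuous \<open>\<psi>\<close> that vanish below some \<open>c > |\<xi>| / r\<close>
  (\<open>ridge_null\<close>). This class is closed under antiderivatives and its condition is open in \<open>\<xi>\<close>, so one may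
  differentiate in \<open>\<xi>\<close> along any \<open>\<eta>\<close>; every derivative produces a factor \<open>\<eta> \<bullet> Y\<close>, and so
  \<open>\<integral> \<psi> (\<xi> \<bullet> Y) (\<eta> \<bullet> Y)\<^sup>k f = 0\<close> for all \<open>k\<close> (\<open>moment_null\<close>). By the Weierstrass theorem the
  power may be replaced with any continuous function of \<open>\<eta> \<bullet> Y\<close> (\<open>product_null\<close>). Products of two hat
  functions in orthogonal directions concentrate near any point beyond the radius \<open>1/r\<close>,
  which forces \<open>f = 0\<close>.
\<close>

section \<open>Integrals against functions of a bounded map\<close>

lemma integrable_mult_bounded_on_support:
  fixes f g :: "'a \<Rightarrow> real"
  assumes f: "integrable M f" and g: "g \<in> borel_measurable M"
    and bnd: "\<And>x. x \<in> space M \<Longrightarrow> f x \<noteq> 0 \<Longrightarrow> \<bar>g x\<bar> \<le> B"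
  shows "integrable M (\<lambda>x. g x * f x)"
proof (rule Bochner_Integration.integrable_bound)
  show "integrable M (\<lambda>x. B * f x)" using f by simp
  show "(\<lambda>x. g x * f x) \<in> borel_measurable M" using f g by measurable
  show "AE x in M. norm (g x * f x) \<le> norm (B * f x)"
  proof (rule AE_I2)
    fix x assume x: "x \<in> space M"
    show "norm (g x * f x) \<le> norm (B * f x)"
    proof (cases "f x = 0")
      case False
      have "\<bar>g x\<bar> \<le> \<bar>B\<bar>" using bnd[OF x False] by linarith
      then show ?thesis by (simp add: abs_mult mult_right_mono)
    qed simp
  qed
qed

lemma continuous_bounded_on_interval:
  fixes \<psi> :: "real \<Rightarrow> real"
  assumes "continuous_on UNIV \<psi>"
  obtains B where "\<And>t. \<bar>t\<bar> \<le> W \<Longrightarrow> \<bar>\<psi> t\<bar> \<le> B"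
proof -
  have "compact (\<psi> ` {-W..W})"
    by (rule compact_continuous_image) (auto intro: continuous_on_subset[OF assms])
  then have "bounded (\<psi> ` {-W..W})" by (rule compact_imp_bounded)
  then obtain B where "\<forall>y \<in> \<psi> ` {-W..W}. norm y \<le> B" unfolding bounded_iff by blast
  then have "\<bar>\<psi> t\<bar> \<le> B" if "\<bar>t\<bar> \<le> W" for t using that by (simp add: abs_le_iff)
  then show ?thesis using that by blast
qed

section \<open>Measures that vanish on exterior half-spaces\<close>

text \<open>
  The image under \<open>Y\<close> of the signed measure \<open>f dM\<close> is carried by the ball of radius \<open>R\<close> and
  vanishes on each closed half-space that misses the ball of radius \<open>a\<close>. Normals \<open>\<xi>\<close> of any
  length are admitted, so that they form a vector space in which to differentiate.
\<close>

locale exterior_null =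
  fixes M :: "'a measure" and f :: "'a \<Rightarrow> real" and Y :: "'a \<Rightarrow> 'e::euclidean_space"
    and R a :: real
  assumes integrable_f: "integrable M f"
    and measurable_Y: "Y \<in> borel_measurable M"
    and bounded_Y: "\<And>x. f x \<noteq> 0 \<Longrightarrow> norm (Y x) \<le> R"
    and halfspace_null:
      "\<And>\<xi> c. a * norm \<xi> < c \<Longrightarrow> (\<integral>x. indicator {x. c \<le> \<xi> \<bullet> Y x} x * f x \<partial>M) = 0"
begin

lemma inner_Y_bound:
  assumes "f x \<noteq> 0" shows "\<bar>\<xi> \<bullet> Y x\<bar> \<le> norm \<xi> * R"
proof -
  have "\<bar>\<xi> \<bullet> Y x\<bar> \<le> norm \<xi> * norm (Y x)" by (rule Cauchy_Schwarz_ineq2)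
  also have "\<dots> \<le> norm \<xi> * R" using bounded_Y[OF assms] by (simp add: mult_left_mono)
  finally show ?thesis .
qed

lemma measurable_inner_Y [measurable]: "(\<lambda>x. \<xi> \<bullet> Y x) \<in> borel_measurable M"
  using measurable_Y by measurable

lemma measurable_continuous_inner_Y:
  fixes \<psi> :: "real \<Rightarrow> real"
  assumes "continuous_on UNIV \<psi>"
  shows "(\<lambda>x. \<psi> (\<xi> \<bullet> Y x)) \<in> borel_measurable M"
  using measurable_compose[OF measurable_inner_Y borel_measurable_continuous_onI[OF assms]] .

lemma integrable_continuous_mult_continuous:
  fixes \<psi> \<theta> :: "real \<Rightarrow> real"
  assumes \<psi>: "continuous_on UNIV \<psi>" and \<theta>: "continuous_on UNIV \<theta>"
  shows "integrable M (\<lambda>x. \<psi> (\<xi> \<bullet> Y x) * \<theta> (\<eta> \<bullet> Y x) * f x)"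
proof -
  obtain B where B: "\<And>t. \<bar>t\<bar> \<le> norm \<xi> * R \<Longrightarrow> \<bar>\<psi> t\<bar> \<le> B"
    using continuous_bounded_on_interval[OF \<psi>] by blast
  obtain C where C: "\<And>t. \<bar>t\<bar> \<le> norm \<eta> * R \<Longrightarrow> \<bar>\<theta> t\<bar> \<le> C"
    using continuous_bounded_on_interval[OF \<theta>] by blast
  show ?thesis
  proof (rule integrable_mult_bounded_on_support[OF integrable_f, where B = "B * C"])
    show "(\<lambda>x. \<psi> (\<xi> \<bullet> Y x) * \<theta> (\<eta> \<bullet> Y x)) \<in> borel_measurable M"
      by (intro borel_measurable_times measurable_continuous_inner_Y \<psi> \<theta>)
    fix x assume "f x \<noteq> 0"
    then have "\<bar>\<psi> (\<xi> \<bullet> Y x)\<bar> \<le> B" "\<bar>\<theta> (\<eta> \<bullet> Y x)\<bar> \<le> C"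
      using B C inner_Y_bound by auto
    then show "\<bar>\<psi> (\<xi> \<bullet> Y x) * \<theta> (\<eta> \<bullet> Y x)\<bar> \<le> B * C"
      unfolding abs_mult by (intro mult_mono) auto
  qed
qed

text \<open>
  Rounding \<open>\<xi> \<bullet> Y\<close> down to a multiple of \<open>1/N\<close> makes the integrand a finite combination of
  differences of half-space indicators; a half-space below level \<open>c\<close> enters with the
  coefficient \<open>0\<close>.
\<close>

lemma ridge_step_null:
  fixes \<psi> :: "real \<Rightarrow> real" and N :: nat
  assumes c: "a * norm \<xi> < c" and zero: "\<And>t. t \<le> c \<Longrightarrow> \<psi> t = 0" and N: "N > 0"
  shows "(\<integral>x. \<psi> (of_int \<lfloor>real N * (\<xi> \<bullet> Y x)\<rfloor> / real N) * f x \<partial>M) = 0"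
proof -
  define w where "w x = \<xi> \<bullet> Y x" for x
  define K where "K = \<lceil>real N * (norm \<xi> * R)\<rceil> + 1"
  define ind :: "real \<Rightarrow> 'a \<Rightarrow> real" where "ind s = indicator {x. s \<le> w x}" for s
  have [measurable]: "w \<in> borel_measurable M" unfolding w_def by simp
  have ind_int: "integrable M (\<lambda>x. ind s x * f x)" for s
  proof (rule integrable_mult_bounded_on_support[OF integrable_f, where B = 1])
    show "ind s \<in> borel_measurable M" unfolding ind_def by measurable
  qed (auto simp: ind_def indicator_def)
  have ind_null: "(\<integral>x. ind s x * f x \<partial>M) = 0" if "s \<ge> c" for s
    using halfspace_null[of \<xi> s] that c unfolding ind_def w_def by simp
  have eq: "\<psi> (of_int \<lfloor>real N * w x\<rfloor> / real N) * f x
      = (\<Sum>j\<in>{-K..K}. \<psi> (of_int j / N) * (ind (of_int j / N) x * f x - ind ((of_int j + 1) / N) x * f x))"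
    for x
  proof (cases "f x = 0")
    case False
    have "\<bar>real N * w x\<bar> \<le> real N * (norm \<xi> * R)"
      unfolding w_def abs_mult using inner_Y_bound[OF False, of \<xi>] by (simp add: mult_left_mono)
    then have mem: "\<lfloor>real N * w x\<rfloor> \<in> {-K..K}" unfolding K_def by simp linarith
    have diff: "ind (of_int j / N) x * f x - ind ((of_int j + 1) / N) x * f x
        = (if \<lfloor>real N * w x\<rfloor> = j then f x else 0)" for j
    proof -
      have 1: "of_int j / real N \<le> w x \<longleftrightarrow> j \<le> \<lfloor>real N * w x\<rfloor>"
        using N by (simp add: le_floor_iff divide_le_eq mult.commute)
      have 2: "(of_int j + 1) / real N \<le> w x \<longleftrightarrow> j + 1 \<le> \<lfloor>real N * w x\<rfloor>"
        unfolding le_floor_iff using N by (simp add: divide_le_eq mult.commute)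
      show ?thesis unfolding ind_def indicator_def by (simp add: 1 2)
    qed
    have "(\<Sum>j\<in>{-K..K}. \<psi> (of_int j / N) * (ind (of_int j / N) x * f x - ind ((of_int j + 1) / N) x * f x))
      = (\<Sum>j\<in>{-K..K}. if \<lfloor>real N * w x\<rfloor> = j then \<psi> (of_int j / N) * f x else 0)"
      unfolding diff by (intro sum.cong) auto
    also have "\<dots> = \<psi> (of_int \<lfloor>real N * w x\<rfloor> / N) * f x"
      using mem by (subst sum.delta') auto
    finally show ?thesis by simp
  qed simp
  have "(\<integral>x. \<psi> (of_int \<lfloor>real N * w x\<rfloor> / real N) * f x \<partial>M)
     = (\<Sum>j\<in>{-K..K}. \<psi> (of_int j / N) *
         ((\<integral>x. ind (of_int j / N) x * f x \<partial>M) - (\<integral>x. ind ((of_int j + 1) / N) x * f x \<partial>M)))"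
    unfolding eq by (subst Bochner_Integration.integral_sum) (auto intro!: sum.cong ind_int simp: ind_int)
  also have "\<dots> = 0"
  proof (rule sum.neutral, rule ballI)
    fix j assume "j \<in> {-K..K}"
    show "\<psi> (of_int j / N) *
         ((\<integral>x. ind (of_int j / N) x * f x \<partial>M) - (\<integral>x. ind ((of_int j + 1) / N) x * f x \<partial>M)) = 0"
    proof (cases "of_int j / real N \<le> c")
      case False
      moreover have "of_int j / real N \<le> (of_int j + 1) / real N"
        using N by (simp add: divide_right_mono)
      ultimately show ?thesis using ind_null by simp
    qed (simp add: zero)
  qed
  finally show ?thesis unfolding w_def .
qed

text \<open>The limit \<open>N \<longlonglongrightarrow> \<infinity>\<close> of the preceding rounding, by dominated convergence.\<close>

lemma ridge_null:
  fixes \<psi> :: "real \<Rightarrow> real"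
  assumes c: "a * norm \<xi> < c" and \<psi>: "continuous_on UNIV \<psi>" and zero: "\<And>t. t \<le> c \<Longrightarrow> \<psi> t = 0"
  shows "(\<integral>x. \<psi> (\<xi> \<bullet> Y x) * f x \<partial>M) = 0"
proof -
  define w where "w x = \<xi> \<bullet> Y x" for x
  define q where "q N t = of_int \<lfloor>real (Suc N) * t\<rfloor> / real (Suc N)" for N t
  have [measurable]: "w \<in> borel_measurable M" unfolding w_def by simp
  have q_bound: "\<bar>q N t - t\<bar> \<le> inverse (real (Suc N))" for N t
  proof -
    have "\<bar>of_int \<lfloor>real (Suc N) * t\<rfloor> - real (Suc N) * t\<bar> \<le> 1" by linarith
    moreover have "q N t - t = (of_int \<lfloor>real (Suc N) * t\<rfloor> - real (Suc N) * t) / real (Suc N)"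
      unfolding q_def by (simp add: field_simps)
    ultimately show ?thesis
      by (simp add: abs_divide divide_right_mono inverse_eq_divide)
  qed
  have q_lim: "(\<lambda>N. q N t) \<longlonglongrightarrow> t" for t
  proof -
    have "(\<lambda>N. q N t - t) \<longlonglongrightarrow> 0"
      by (rule Lim_null_comparison[OF _ LIMSEQ_inverse_real_of_nat]) (use q_bound in auto)
    then show ?thesis by (simp add: LIM_zero_iff)
  qed
  obtain B where B: "\<And>t. \<bar>t\<bar> \<le> norm \<xi> * R + 1 \<Longrightarrow> \<bar>\<psi> t\<bar> \<le> B"
    using continuous_bounded_on_interval[OF \<psi>] by blast
  have meas_\<psi>: "\<psi> \<in> borel_measurable borel" using \<psi> by (rule borel_measurable_continuous_onI)
  have "(\<lambda>N. \<integral>x. \<psi> (q N (w x)) * f x \<partial>M) \<longlonglongrightarrow> (\<integral>x. \<psi> (w x) * f x \<partial>M)"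
  proof (rule integral_dominated_convergence[where w = "\<lambda>x. \<bar>B * f x\<bar>"])
    show "(\<lambda>x. \<psi> (w x) * f x) \<in> borel_measurable M"
      using integrable_f meas_\<psi> by measurable
    show "(\<lambda>x. \<psi> (q N (w x)) * f x) \<in> borel_measurable M" for N
      using integrable_f meas_\<psi> unfolding q_def by measurable
    show "integrable M (\<lambda>x. \<bar>B * f x\<bar>)"
      by (intro integrable_abs integrable_mult_right integrable_f)
    show "AE x in M. (\<lambda>N. \<psi> (q N (w x)) * f x) \<longlonglongrightarrow> \<psi> (w x) * f x"
    proof (rule AE_I2)
      fix x
      have "(\<lambda>N. \<psi> (q N (w x))) \<longlonglongrightarrow> \<psi> (w x)"
        using \<psi> q_lim by (intro isCont_tendsto_compose[of "w x" \<psi>])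
          (auto simp: continuous_on_eq_continuous_at)
      then show "(\<lambda>N. \<psi> (q N (w x)) * f x) \<longlonglongrightarrow> \<psi> (w x) * f x"
        by (intro tendsto_mult tendsto_const)
    qed
    show "AE x in M. norm (\<psi> (q N (w x)) * f x) \<le> \<bar>B * f x\<bar>" for N
    proof (rule AE_I2)
      fix x
      show "norm (\<psi> (q N (w x)) * f x) \<le> \<bar>B * f x\<bar>"
      proof (cases "f x = 0")
        case False
        have "inverse (real (Suc N)) \<le> 1" by (simp add: inverse_le_1_iff)
        then have "\<bar>q N (w x)\<bar> \<le> norm \<xi> * R + 1"
          using q_bound[of N "w x"] inner_Y_bound[OF False, of \<xi>] unfolding w_def by linarith
        then have "\<bar>\<psi> (q N (w x))\<bar> \<le> \<bar>B\<bar>" using B abs_ge_self order_trans by blast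
        then show ?thesis by (simp add: abs_mult mult_right_mono)
      qed simp
    qed
  qed
  moreover have "(\<integral>x. \<psi> (q N (w x)) * f x \<partial>M) = 0" for N
    unfolding q_def w_def using ridge_step_null[of \<xi> c \<psi> "Suc N"] c zero by simp
  ultimately show ?thesis unfolding w_def by (simp add: LIMSEQ_const_iff)
qed

text \<open>
  If \<open>\<Psi>\<close> is the antiderivative of \<open>\<psi>\<close> from \<open>c\<close>, then it also vanishes below \<open>c\<close>, and
  \<open>\<psi> (\<xi> \<bullet> Y) (\<eta> \<bullet> Y)\<^sup>k\<^sup>+\<^sup>1\<close> is the derivative at \<open>t = 0\<close> of \<open>\<Psi> ((\<xi> + t \<eta>) \<bullet> Y) (\<eta> \<bullet> Y)\<^sup>k\<close>. By the
  induction hypothesis the integrals of the latter vanish for all small \<open>t\<close>, and hence so does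
  the integral of the derivative.
\<close>

lemma moment_null:
  fixes \<psi> :: "real \<Rightarrow> real"
  assumes c: "a * norm \<xi> < c" and \<psi>: "continuous_on UNIV \<psi>" and zero: "\<And>t. t \<le> c \<Longrightarrow> \<psi> t = 0"
  shows "(\<integral>x. \<psi> (\<xi> \<bullet> Y x) * (\<eta> \<bullet> Y x) ^ k * f x \<partial>M) = 0"
  using assms
proof (induction k arbitrary: \<xi> c \<psi>)
  case 0
  then show ?case using ridge_null by simp
next
  case (Suc k)
  note c = Suc.prems(1) and \<psi> = Suc.prems(2) and zero = Suc.prems(3)
  \<comment> \<open>All arguments of \<open>\<Psi>\<close> below stay in \<open>[-W, W]\<close>, as the step sizes \<open>h i\<close> are at most \<open>1\<close>.\<close>
  define W where "W = \<bar>norm \<xi> * R\<bar> + \<bar>norm \<eta> * R\<bar> + \<bar>c\<bar>"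
  define \<Psi> where "\<Psi> t = integral {c..t} \<psi>" for t
  have \<Psi>_zero: "\<Psi> t = 0" if "t \<le> c" for t
    using that unfolding \<Psi>_def by (cases "t = c") auto
  have \<Psi>_deriv: "(\<Psi> has_real_derivative \<psi> t) (at t)" for t
  proof (cases "t < c")
    case True
    have "((\<lambda>_. 0) has_real_derivative 0) (at t)" by simp
    then have "(\<Psi> has_real_derivative 0) (at t)"
    proof (rule has_field_derivative_transform_within_open[of _ _ _ "{..<c}"])
    qed (use True \<Psi>_zero in auto)
    then show ?thesis using zero True by simp
  next
    case False
    \<comment> \<open>Starting the integral at \<open>c - 1\<close> changes nothing above \<open>c - 1\<close> and makes \<open>t = c\<close> an
      interior point.\<close>
    define \<Phi> where "\<Phi> s = integral {c - 1..s} \<psi>" for s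
    have "(\<Phi> has_real_derivative \<psi> t) (at t within {c - 1..t + 1})"
      unfolding \<Phi>_def
      by (rule integral_has_real_derivative)
        (use False continuous_on_subset[OF \<psi>] in auto)
    then have D: "(\<Phi> has_real_derivative \<psi> t) (at t)"
      using False by (subst (asm) at_within_Icc_at) auto
    have "\<Phi> s = \<Psi> s" if "s \<in> {c - 1<..}" for s
    proof (cases "s \<le> c")
      case True
      have "\<Phi> s = integral {c - 1..s} (\<lambda>_. 0)"
        unfolding \<Phi>_def by (rule Henstock_Kurzweil_Integration.integral_cong) (use True zero in auto)
      then show ?thesis using \<Psi>_zero True by simp
    next
      case False
      have "integral {c - 1..c} \<psi> + integral {c..s} \<psi> = integral {c - 1..s} \<psi>"
        by (rule Henstock_Kurzweil_Integration.integral_combine)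
          (use False continuous_on_subset[OF \<psi>] in \<open>auto intro!: integrable_continuous_interval\<close>)
      moreover have "integral {c - 1..c} \<psi> = integral {c - 1..c} (\<lambda>_. 0)"
        by (rule Henstock_Kurzweil_Integration.integral_cong) (use zero in auto)
      ultimately show ?thesis unfolding \<Phi>_def \<Psi>_def by simp
    qed
    then show ?thesis
      using has_field_derivative_transform_within_open[OF D, of "{c - 1<..}" \<Psi>] False by auto
  qed
  have \<Psi>_cont: "continuous_on UNIV \<Psi>"
    using \<Psi>_deriv by (meson DERIV_isCont continuous_at_imp_continuous_on)
  obtain B where B: "\<And>t. \<bar>t\<bar> \<le> W \<Longrightarrow> \<bar>\<psi> t\<bar> \<le> B"
    using continuous_bounded_on_interval[OF \<psi>] by blast
  have \<Psi>_lip: "\<bar>\<Psi> s - \<Psi> t\<bar> \<le> B * \<bar>s - t\<bar>" if "\<bar>s\<bar> \<le> W" "\<bar>t\<bar> \<le> W" for s t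
    using field_differentiable_bound[of "{-W..W}" \<Psi> \<psi> B s t] that B
      has_field_derivative_at_within[OF \<Psi>_deriv] by (auto simp: abs_le_iff)
  define h where "h i = inverse (real (Suc i))" for i
  have h: "h i > 0" "h i \<le> 1" for i unfolding h_def by (auto simp: inverse_le_1_iff)
  have h_lim: "h \<longlonglongrightarrow> 0" unfolding h_def by (rule LIMSEQ_inverse_real_of_nat)
  define Q where "Q i x = (\<Psi> ((\<xi> + h i *\<^sub>R \<eta>) \<bullet> Y x) - \<Psi> (\<xi> \<bullet> Y x)) / h i" for i x
  have meas: "(\<lambda>x. Q i x * (\<eta> \<bullet> Y x) ^ k * f x) \<in> borel_measurable M" for i
    unfolding Q_def using integrable_f
    by (intro borel_measurable_times borel_measurable_divide borel_measurable_diff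
        measurable_continuous_inner_Y \<Psi>_cont borel_measurable_power measurable_inner_Y) auto
  have lim: "(\<lambda>i. \<integral>x. Q i x * (\<eta> \<bullet> Y x) ^ k * f x \<partial>M)
      \<longlonglongrightarrow> (\<integral>x. \<psi> (\<xi> \<bullet> Y x) * (\<eta> \<bullet> Y x) ^ Suc k * f x \<partial>M)"
  proof (rule integral_dominated_convergence[where w = "\<lambda>x. \<bar>B * \<bar>norm \<eta> * R\<bar> ^ Suc k * f x\<bar>"])
    show "(\<lambda>x. \<psi> (\<xi> \<bullet> Y x) * (\<eta> \<bullet> Y x) ^ Suc k * f x) \<in> borel_measurable M"
      using integrable_f
      by (intro borel_measurable_times measurable_continuous_inner_Y \<psi> borel_measurable_power
          measurable_inner_Y) auto
    show "(\<lambda>x. Q i x * (\<eta> \<bullet> Y x) ^ k * f x) \<in> borel_measurable M" for i by (rule meas)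
    show "integrable M (\<lambda>x. \<bar>B * \<bar>norm \<eta> * R\<bar> ^ Suc k * f x\<bar>)"
      by (intro integrable_abs integrable_mult_right integrable_f)
    show "AE x in M. (\<lambda>i. Q i x * (\<eta> \<bullet> Y x) ^ k * f x)
        \<longlonglongrightarrow> \<psi> (\<xi> \<bullet> Y x) * (\<eta> \<bullet> Y x) ^ Suc k * f x"
    proof (rule AE_I2)
      fix x
      have "((\<lambda>s. \<Psi> (\<xi> \<bullet> Y x + s * (\<eta> \<bullet> Y x))) has_real_derivative \<psi> (\<xi> \<bullet> Y x) * (\<eta> \<bullet> Y x)) (at 0)"
        by (rule DERIV_chain2[of \<Psi>]) (use \<Psi>_deriv in \<open>auto intro!: derivative_eq_intros\<close>)
      then have "((\<lambda>s. (\<Psi> (\<xi> \<bullet> Y x + s * (\<eta> \<bullet> Y x)) - \<Psi> (\<xi> \<bullet> Y x)) / s)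
          \<longlongrightarrow> \<psi> (\<xi> \<bullet> Y x) * (\<eta> \<bullet> Y x)) (at 0)"
        by (simp add: DERIV_def)
      then have "(\<lambda>i. Q i x) \<longlonglongrightarrow> \<psi> (\<xi> \<bullet> Y x) * (\<eta> \<bullet> Y x)"
        unfolding Q_def inner_add_left inner_scaleR_left
        by (rule filterlim_compose) (use h h_lim in \<open>auto simp: filterlim_at less_imp_neq[symmetric]\<close>)
      from tendsto_mult[OF tendsto_mult[OF this tendsto_const] tendsto_const, of "(\<eta> \<bullet> Y x) ^ k" "f x"]
      show "(\<lambda>i. Q i x * (\<eta> \<bullet> Y x) ^ k * f x) \<longlonglongrightarrow> \<psi> (\<xi> \<bullet> Y x) * (\<eta> \<bullet> Y x) ^ Suc k * f x"
        by (simp add: mult.assoc)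
    qed
    show "AE x in M. norm (Q i x * (\<eta> \<bullet> Y x) ^ k * f x) \<le> \<bar>B * \<bar>norm \<eta> * R\<bar> ^ Suc k * f x\<bar>" for i
    proof (rule AE_I2)
      fix x
      show "norm (Q i x * (\<eta> \<bullet> Y x) ^ k * f x) \<le> \<bar>B * \<bar>norm \<eta> * R\<bar> ^ Suc k * f x\<bar>"
      proof (cases "f x = 0")
        case False
        define v where "v = \<xi> \<bullet> Y x"
        define u where "u = \<eta> \<bullet> Y x"
        have v: "\<bar>v\<bar> \<le> \<bar>norm \<xi> * R\<bar>" and u: "\<bar>u\<bar> \<le> \<bar>norm \<eta> * R\<bar>"
          using inner_Y_bound[OF False] unfolding u_def v_def by (auto intro: order_trans[OF _ abs_ge_self])
        have "\<bar>h i * u\<bar> \<le> \<bar>u\<bar>" using h[of i] by (simp add: abs_mult mult_left_le_one_le)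
        then have "\<bar>v + h i * u\<bar> \<le> W" "\<bar>v\<bar> \<le> W" using u v unfolding W_def by linarith+
        from \<Psi>_lip[OF this] have "\<bar>\<Psi> (v + h i * u) - \<Psi> v\<bar> \<le> B * (h i * \<bar>u\<bar>)"
          using h[of i] by (simp add: abs_mult)
        then have Q: "\<bar>Q i x\<bar> \<le> B * \<bar>u\<bar>"
          using h[of i] unfolding Q_def u_def v_def inner_add_left inner_scaleR_left
          by (simp add: abs_divide divide_le_eq algebra_simps)
        have "0 \<le> \<bar>\<psi> 0\<bar>" by simp
        also have "\<dots> \<le> B" using B[of 0] by (simp add: W_def)
        finally have B0: "0 \<le> B" .
        have "\<bar>Q i x\<bar> * \<bar>u\<bar> ^ k * \<bar>f x\<bar> \<le> (B * \<bar>u\<bar>) * \<bar>u\<bar> ^ k * \<bar>f x\<bar>"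
          using Q by (intro mult_right_mono) auto
        also have "\<dots> = B * \<bar>u\<bar> ^ Suc k * \<bar>f x\<bar>" by simp
        also have "\<dots> \<le> B * \<bar>norm \<eta> * R\<bar> ^ Suc k * \<bar>f x\<bar>"
          using B0 u by (intro mult_right_mono mult_left_mono power_mono) auto
        finally show ?thesis using B0 unfolding u_def by (simp add: abs_mult power_abs)
      qed simp
    qed
  qed
  have "eventually (\<lambda>i. (\<integral>x. Q i x * (\<eta> \<bullet> Y x) ^ k * f x \<partial>M) = 0) sequentially"
  proof -
    have "(\<lambda>i. a * norm (\<xi> + h i *\<^sub>R \<eta>)) \<longlonglongrightarrow> a * norm (\<xi> + 0 *\<^sub>R \<eta>)"
      by (intro tendsto_intros h_lim)
    then have "eventually (\<lambda>i. a * norm (\<xi> + h i *\<^sub>R \<eta>) < c) sequentially"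
      using c by (intro order_tendstoD(2)[where y = "a * norm \<xi>"]) auto
    then show ?thesis
    proof (eventually_elim)
      case (elim i)
      have int: "integrable M (\<lambda>x. \<Psi> (\<zeta> \<bullet> Y x) * (\<eta> \<bullet> Y x) ^ k * f x)" for \<zeta>
        by (rule integrable_continuous_mult_continuous[OF \<Psi>_cont]) (intro continuous_intros)
      have "(\<integral>x. Q i x * (\<eta> \<bullet> Y x) ^ k * f x \<partial>M)
        = (\<integral>x. (\<Psi> ((\<xi> + h i *\<^sub>R \<eta>) \<bullet> Y x) * (\<eta> \<bullet> Y x) ^ k * f x
              - \<Psi> (\<xi> \<bullet> Y x) * (\<eta> \<bullet> Y x) ^ k * f x) / h i \<partial>M)"
        unfolding Q_def by (intro Bochner_Integration.integral_cong) (auto simp: diff_divide_distrib algebra_simps)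
      also have "\<dots> = ((\<integral>x. \<Psi> ((\<xi> + h i *\<^sub>R \<eta>) \<bullet> Y x) * (\<eta> \<bullet> Y x) ^ k * f x \<partial>M)
              - (\<integral>x. \<Psi> (\<xi> \<bullet> Y x) * (\<eta> \<bullet> Y x) ^ k * f x \<partial>M)) / h i"
        using int by (simp only: integral_divide_zero Bochner_Integration.integral_diff)
      also have "\<dots> = 0"
        using Suc.IH[OF elim \<Psi>_cont \<Psi>_zero] Suc.IH[OF c \<Psi>_cont \<Psi>_zero] by simp
      finally show ?case .
    qed
  qed
  then have "(\<lambda>i. \<integral>x. Q i x * (\<eta> \<bullet> Y x) ^ k * f x \<partial>M) \<longlonglongrightarrow> 0"
    by (rule tendsto_eventually)
  with lim show ?case by (rule LIMSEQ_unique)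
qed

text \<open>
  On the support of \<open>f\<close> the values \<open>\<eta> \<bullet> Y\<close> stay in a compact interval, on which \<open>\<theta>\<close> is a
  uniform limit of polynomials.
\<close>

lemma product_null:
  fixes \<psi> \<theta> :: "real \<Rightarrow> real"
  assumes c: "a * norm \<xi> < c" and \<psi>: "continuous_on UNIV \<psi>" and zero: "\<And>t. t \<le> c \<Longrightarrow> \<psi> t = 0"
    and \<theta>: "continuous_on UNIV \<theta>"
  shows "(\<integral>x. \<psi> (\<xi> \<bullet> Y x) * \<theta> (\<eta> \<bullet> Y x) * f x \<partial>M) = 0" (is "?I = 0")
proof -
  define W where "W = norm \<eta> * R"
  define L where "L = (\<integral>x. \<bar>\<psi> (\<xi> \<bullet> Y x) * f x\<bar> \<partial>M)"
  have int1: "integrable M (\<lambda>x. \<psi> (\<xi> \<bullet> Y x) * f x)"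
    using integrable_continuous_mult_continuous[OF \<psi>, of "\<lambda>_. 1"] by simp
  have L: "L \<ge> 0" unfolding L_def by simp
  have bound: "\<bar>?I\<bar> \<le> e * L" if e: "e > 0" for e
  proof -
    obtain P where P: "real_polynomial_function P" "\<And>t. t \<in> {-W..W} \<Longrightarrow> \<bar>\<theta> t - P t\<bar> < e"
      using Stone_Weierstrass_real_polynomial_function[of "{-W..W}" \<theta> e] e
        continuous_on_subset[OF \<theta>] by auto
    then obtain b n where Pbn: "P = (\<lambda>t. \<Sum>i\<le>n. b i * t ^ i)"
      using real_polynomial_function_iff_sum by blast
    have Pc: "continuous_on UNIV P" unfolding Pbn by (intro continuous_intros)
    have intm: "integrable M (\<lambda>x. \<psi> (\<xi> \<bullet> Y x) * (\<eta> \<bullet> Y x) ^ i * f x)" for i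
      by (rule integrable_continuous_mult_continuous[OF \<psi>]) (intro continuous_intros)
    have "(\<integral>x. \<psi> (\<xi> \<bullet> Y x) * P (\<eta> \<bullet> Y x) * f x \<partial>M)
       = (\<integral>x. (\<Sum>i\<le>n. b i * (\<psi> (\<xi> \<bullet> Y x) * (\<eta> \<bullet> Y x) ^ i * f x)) \<partial>M)"
      unfolding Pbn by (simp add: sum_distrib_left sum_distrib_right mult_ac)
    also have "\<dots> = (\<Sum>i\<le>n. b i * (\<integral>x. \<psi> (\<xi> \<bullet> Y x) * (\<eta> \<bullet> Y x) ^ i * f x \<partial>M))"
      by (subst Bochner_Integration.integral_sum) (auto intro!: intm)
    also have "\<dots> = 0" using moment_null[OF c \<psi> zero] by simp
    finally have P0: "(\<integral>x. \<psi> (\<xi> \<bullet> Y x) * P (\<eta> \<bullet> Y x) * f x \<partial>M) = 0" .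
    have "?I = ?I - (\<integral>x. \<psi> (\<xi> \<bullet> Y x) * P (\<eta> \<bullet> Y x) * f x \<partial>M)" using P0 by simp
    also have "\<dots> = (\<integral>x. \<psi> (\<xi> \<bullet> Y x) * \<theta> (\<eta> \<bullet> Y x) * f x - \<psi> (\<xi> \<bullet> Y x) * P (\<eta> \<bullet> Y x) * f x \<partial>M)"
      by (intro Bochner_Integration.integral_diff[symmetric] integrable_continuous_mult_continuous \<psi> \<theta> Pc)
    also have "\<bar>\<dots>\<bar> \<le> (\<integral>x. e * \<bar>\<psi> (\<xi> \<bullet> Y x) * f x\<bar> \<partial>M)"
    proof (rule order_trans[OF integral_abs_bound integral_mono])
      show "integrable M (\<lambda>x. \<bar>\<psi> (\<xi> \<bullet> Y x) * \<theta> (\<eta> \<bullet> Y x) * f x - \<psi> (\<xi> \<bullet> Y x) * P (\<eta> \<bullet> Y x) * f x\<bar>)"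
        by (intro integrable_abs Bochner_Integration.integrable_diff integrable_continuous_mult_continuous \<psi> \<theta> Pc)
      show "integrable M (\<lambda>x. e * \<bar>\<psi> (\<xi> \<bullet> Y x) * f x\<bar>)"
        using int1 by (intro integrable_mult_right integrable_abs)
      fix x
      show "\<bar>\<psi> (\<xi> \<bullet> Y x) * \<theta> (\<eta> \<bullet> Y x) * f x - \<psi> (\<xi> \<bullet> Y x) * P (\<eta> \<bullet> Y x) * f x\<bar>
          \<le> e * \<bar>\<psi> (\<xi> \<bullet> Y x) * f x\<bar>"
      proof (cases "f x = 0")
        case False
        have "\<eta> \<bullet> Y x \<in> {-W..W}"
          using inner_Y_bound[OF False, of \<eta>] unfolding W_def by (simp add: abs_le_iff minus_le_iff)
        from P(2)[OF this] have "\<bar>\<theta> (\<eta> \<bullet> Y x) - P (\<eta> \<bullet> Y x)\<bar> \<le> e" by simp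
        from mult_right_mono[OF this, of "\<bar>\<psi> (\<xi> \<bullet> Y x) * f x\<bar>"]
        show ?thesis unfolding abs_mult[symmetric] by (simp add: algebra_simps)
      qed simp
    qed
    also have "\<dots> = e * L" unfolding L_def by simp
    finally show ?thesis .
  qed
  have "\<bar>?I\<bar> \<le> 0 + e" if "e > 0" for e
  proof -
    have "\<bar>?I\<bar> \<le> e / (L + 1) * L" using bound[of "e / (L + 1)"] that L by simp
    also have "\<dots> \<le> e" using that L by (simp add: field_simps)
    finally show ?thesis by simp
  qed
  then have "\<bar>?I\<bar> \<le> 0" by (rule field_le_epsilon)
  then show ?thesis by simp
qed

end

section \<open>Inversion in the unit circle\<close>

definition inversion :: "'a::real_inner \<Rightarrow> 'a" where
  "inversion x = x /\<^sub>R (norm x)\<^sup>2"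

lemma norm_inversion: "norm (inversion x) = inverse (norm x)"
  by (cases "x = 0") (auto simp: inversion_def power2_eq_square divide_simps)

lemma norm_diff_inversion:
  fixes x y :: "'a::real_inner"
  assumes "x \<noteq> 0" "y \<noteq> 0"
  shows "norm (inversion x - inversion y) = norm (x - y) / (norm x * norm y)"
proof (rule power2_eq_imp_eq)
  have sq: "(norm (u - v))\<^sup>2 = (norm u)\<^sup>2 - 2 * (u \<bullet> v) + (norm v)\<^sup>2" for u v :: 'a
    by (simp add: power2_norm_eq_inner inner_diff_left inner_diff_right inner_commute)
  have "inversion x \<bullet> inversion y = (x \<bullet> y) / ((norm x)\<^sup>2 * (norm y)\<^sup>2)"
    by (simp add: inversion_def divide_simps)
  then show "(norm (inversion x - inversion y))\<^sup>2 = (norm (x - y) / (norm x * norm y))\<^sup>2"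
    using assms unfolding sq norm_inversion power_divide power_mult_distrib
    by (simp add: field_simps)
qed auto

lemma isCont_inversion: "x \<noteq> 0 \<Longrightarrow> isCont inversion x"
  unfolding inversion_def by (intro continuous_intros) auto

lemma measurable_inversion: "(inversion :: 'a::euclidean_space \<Rightarrow> 'a) \<in> borel_measurable borel"
  unfolding inversion_def by measurable

lemma polar_eq_scaleR: "polar s \<phi> = s *\<^sub>R polar 1 \<phi>"
  by (simp add: polar_def vec_eq_iff forall_2)

lemma norm_polar: "norm (polar 1 \<phi>) = 1"
  by (simp add: polar_def norm_vec_def L2_set_def sum_2)

text \<open>
  A point \<open>x\<close> lies in the disc of diameter \<open>1/p\<close> through the origin iff
  \<open>|x|\<^sup>2 \<le> (e \<bullet> x) / p\<close>, where \<open>e\<close> is the unit vector towards the centre; dividing by \<open>|x|\<^sup>2\<close>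
  gives a half-plane condition on the inverted point.
\<close>

lemma mem_disc_iff_inversion:
  assumes "p > 0" "x \<noteq> 0"
  shows "x \<in> disc (1 / p) \<phi> \<longleftrightarrow> p \<le> polar 1 \<phi> \<bullet> inversion x"
proof -
  define e where "e = polar 1 \<phi>"
  have e: "e \<bullet> e = 1" unfolding e_def using norm_polar[of \<phi>] by (simp add: norm_eq_1)
  define s where "s = 1 / p / 2"
  have s: "s > 0" "2 * s * p = 1" using assms by (auto simp: s_def)
  have "x \<in> disc (1 / p) \<phi> \<longleftrightarrow> norm (s *\<^sub>R e - x) \<le> s"
    unfolding disc_def s_def[symmetric] polar_eq_scaleR[of s] by (simp add: dist_norm e_def)
  also have "\<dots> \<longleftrightarrow> (norm (s *\<^sub>R e - x))\<^sup>2 \<le> s\<^sup>2"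
    using s by (simp add: abs_le_square_iff[symmetric])
  also have "(norm (s *\<^sub>R e - x))\<^sup>2 = s\<^sup>2 - 2 * s * (e \<bullet> x) + (norm x)\<^sup>2"
    unfolding power2_norm_eq_inner
    by (simp add: inner_diff_left inner_diff_right e inner_commute power2_eq_square)
  also have "\<dots> \<le> s\<^sup>2 \<longleftrightarrow> p * (norm x)\<^sup>2 \<le> e \<bullet> x"
  proof -
    have "(norm x)\<^sup>2 \<le> 2 * s * (e \<bullet> x) \<longleftrightarrow> p * (norm x)\<^sup>2 \<le> p * (2 * s * (e \<bullet> x))"
      using mult_le_cancel_left_pos[OF assms(1)] by blast
    also have "p * (2 * s * (e \<bullet> x)) = e \<bullet> x" using s(2) by (metis mult.assoc mult.commute mult_1)
    finally show ?thesis by linarith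
  qed
  also have "\<dots> \<longleftrightarrow> p \<le> e \<bullet> inversion x"
    using assms by (simp add: inversion_def field_simps)
  finally show ?thesis unfolding e_def .
qed

section \<open>Localisation and supports\<close>

lemma integral_zero_imp_zero_at_continuity_point:
  fixes F :: "'a::euclidean_space \<Rightarrow> real"
  assumes int: "integrable lborel F" and nonneg: "\<And>x. 0 \<le> F x"
    and null: "(\<integral>x. F x \<partial>lborel) = 0" and cont: "isCont F z"
  shows "F z = 0"
proof (rule ccontr)
  assume "F z \<noteq> 0"
  then have "0 < F z" using nonneg[of z] by simp
  with cont have "eventually (\<lambda>x. 0 < F x) (nhds z)"
    unfolding continuous_at tendsto_at_iff_tendsto_nhds by (rule order_tendstoD)
  then obtain S where S: "open S" "z \<in> S" "\<And>x. x \<in> S \<Longrightarrow> 0 < F x"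
    unfolding eventually_nhds by blast
  have "AE x in lborel. F x = 0"
    using integral_nonneg_eq_0_iff_AE[OF int] nonneg null by simp
  then obtain N where "{x \<in> space lborel. \<not> F x = 0} \<subseteq> N" "emeasure lborel N = 0" "N \<in> sets lborel"
    by (rule AE_E)
  then have N: "{x. F x \<noteq> 0} \<subseteq> N" "N \<in> null_sets lborel" by (auto intro: null_setsI)
  have "S \<subseteq> N" using S(3) N(1) by force
  moreover have "negligible N"
    using N(2) by (simp add: negligible_iff_null_sets null_sets_completionI)
  ultimately have "negligible S" using negligible_subset by blast
  then show False using open_not_negligible[OF S(1)] S(2) by blast
qed

lemma C0_infty_imp_continuous:
  assumes "open \<Omega>" "f \<in> C0_infty \<Omega>"
  shows "continuous_on UNIV f"
proof -
  define K where "K = closure {x. f x \<noteq> 0}"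
  have K: "K \<subseteq> \<Omega>" and f: "continuous_on \<Omega> f"
    using assms(2) unfolding C0_infty_def smooth_on_def K_def by (auto dest: spec[of _ 0])
  have "continuous_on (- K) (\<lambda>_. 0 :: real)" by simp
  then have "continuous_on (- K) f"
  proof (rule continuous_on_eq)
    show "0 = f x" if "x \<in> - K" for x
      using that closure_subset[of "{x. f x \<noteq> 0}"] unfolding K_def by auto
  qed
  then have "continuous_on (\<Omega> \<union> - K) f"
    using f assms(1) by (intro continuous_on_open_Un) (auto simp: K_def)
  moreover have "\<Omega> \<union> - K = UNIV" using K by blast
  ultimately show ?thesis by simp
qed

lemma open_annulus: "open (annulus a b)"
  unfolding annulus_def by (intro open_Collect_conj open_Collect_less continuous_intros)

lemma C0_infty_annulus_support:
  assumes "f \<in> C0_infty (annulus a b)" "f x \<noteq> 0"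
  shows "a < norm x" "norm x < b"
proof -
  have "x \<in> closure {x. f x \<noteq> 0}" using assms(2) by (auto intro: subsetD[OF closure_subset])
  then have "x \<in> annulus a b" using assms(1) unfolding C0_infty_def by blast
  then show "a < norm x" "norm x < b" by (auto simp: annulus_def)
qed

lemma C0_infty_annulus_gap:
  assumes "f \<in> C0_infty (annulus a b)"
  obtains \<rho> where "a < \<rho>" "\<And>x. f x \<noteq> 0 \<Longrightarrow> \<rho> \<le> norm x"
proof (cases "\<exists>x. f x \<noteq> 0")
  case True
  define K where "K = closure {x. f x \<noteq> 0}"
  have sub: "{x. f x \<noteq> 0} \<subseteq> K" unfolding K_def by (rule closure_subset)
  have K: "compact K" "K \<subseteq> annulus a b" using assms unfolding C0_infty_def K_def by auto
  have "K \<noteq> {}" using True sub by blast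
  then obtain z where z: "z \<in> K" "\<And>x. x \<in> K \<Longrightarrow> norm z \<le> norm x"
    using continuous_attains_inf[OF K(1), of norm] by (auto intro: continuous_intros)
  then show ?thesis using that[of "norm z"] K(2) sub by (auto simp: annulus_def)
next
  case False
  then show ?thesis using that[of "a + 1"] by simp
qed

lemma C0_infty_annulus_integrable:
  assumes "f \<in> C0_infty (annulus a b)"
  shows "integrable lborel f"
proof -
  have "integrable lborel (\<lambda>x. indicator (cball 0 b) x *\<^sub>R f x)"
    using C0_infty_imp_continuous[OF open_annulus assms]
    by (intro borel_integrable_compact) (auto intro: continuous_on_subset)
  moreover have "(\<lambda>x. indicator (cball 0 b) x *\<^sub>R f x) = f"
  proof
    fix x
    show "indicator (cball 0 b) x *\<^sub>R f x = f x"
      using C0_infty_annulus_support(2)[OF assms, of x] by (cases "f x = 0") auto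
  qed
  ultimately show ?thesis by simp
qed

section \<open>Injectivity of the disc transform\<close>

lemma disc_transform1_eq_0:
  assumes "p > 0" and far: "\<And>x. f x \<noteq> 0 \<Longrightarrow> 1 / p < norm x"
  shows "disc_transform1 f p \<phi> = 0"
proof -
  have "indicator (disc (1 / p) \<phi>) x *\<^sub>R f x = 0" for x
  proof (cases "x \<in> disc (1 / p) \<phi>")
    case True
    then have d: "norm (polar (1 / p / 2) \<phi> - x) \<le> 1 / p / 2" unfolding disc_def by (simp add: dist_norm)
    have n: "norm (polar (1 / p / 2) \<phi>) = 1 / p / 2"
      unfolding polar_eq_scaleR[of "1 / p / 2"] using \<open>p > 0\<close> by (simp add: norm_polar)
    have "norm x \<le> norm (polar (1 / p / 2) \<phi>) + norm (polar (1 / p / 2) \<phi> - x)"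
      by (metis norm_minus_commute norm_triangle_sub)
    also have "\<dots> \<le> 1 / p / 2 + 1 / p / 2" unfolding n using d by (rule add_left_mono)
    also have "\<dots> = 1 / p" by (rule field_sum_of_halves)
    finally have "norm x \<le> 1 / p" .
    then show ?thesis using far[of x] by auto
  qed simp
  then show ?thesis
    unfolding disc_transform1_def set_lebesgue_integral_def by (simp only: Bochner_Integration.integral_zero)
qed

text \<open>
  The supports of \<open>f\<close> and \<open>g\<close> keep a positive distance from the unit circle, so for some
  \<open>q < 1\<close> the discs of diameter \<open>1/q\<close> miss both of them. There the transforms reduce to the jump
  corrections, which therefore agree and cancel for all other \<open>p\<close>.
\<close>

lemma disc_transform_eq_imp_disc_transform1_eq:
  assumes "r > 1" and f: "f \<in> C0_infty (annulus 1 r)" and g: "g \<in> C0_infty (annulus 1 r)"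
    and eq: "\<And>p. 1 / r < p \<Longrightarrow> p < 1 \<Longrightarrow> disc_transform f p \<phi> = disc_transform g p \<phi>"
    and p: "1 / r < p" "p < 1"
  shows "disc_transform1 f p \<phi> = disc_transform1 g p \<phi>"
proof -
  have pos: "0 < 1 / r" using \<open>r > 1\<close> by simp
  have D: "disc_transform h q \<phi> = disc_transform1 h q \<phi> + jump_correction h \<phi>" if "1 / r < q" for h q
  proof -
    have "0 < q" using that pos by linarith
    then show ?thesis unfolding disc_transform_def disc_transform2_def by simp
  qed
  obtain \<rho> where \<rho>: "1 < \<rho>" "\<And>x. f x \<noteq> 0 \<Longrightarrow> \<rho> \<le> norm x" using C0_infty_annulus_gap[OF f] by blast
  obtain \<sigma> where \<sigma>: "1 < \<sigma>" "\<And>x. g x \<noteq> 0 \<Longrightarrow> \<sigma> \<le> norm x" using C0_infty_annulus_gap[OF g] by blast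
  have "max (1 / r) (max (1 / \<rho>) (1 / \<sigma>)) < 1" using \<open>r > 1\<close> \<rho>(1) \<sigma>(1) by simp
  then obtain q where q: "max (1 / r) (max (1 / \<rho>) (1 / \<sigma>)) < q" "q < 1" using dense by blast
  have "0 < q" using q pos by (meson less_trans max_less_iff_conj)
  have "1 / q < \<rho>" "1 / q < \<sigma>" using q \<open>0 < q\<close> \<rho>(1) \<sigma>(1) by (auto simp: field_simps)
  then have "disc_transform1 f q \<phi> = 0" "disc_transform1 g q \<phi> = 0"
    using \<rho>(2) \<sigma>(2) \<open>0 < q\<close> by (auto intro!: disc_transform1_eq_0 intro: less_le_trans)
  then have "jump_correction f \<phi> = jump_correction g \<phi>"
    using eq[of q] D[of q] q by simp
  then show ?thesis using eq[OF p] D[OF p(1)] by simp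
qed

lemma disc_transform1_diff:
  assumes f: "integrable lborel f" and g: "integrable lborel g"
  shows "disc_transform1 (\<lambda>x. f x - g x) p \<phi> = disc_transform1 f p \<phi> - disc_transform1 g p \<phi>"
proof -
  have "set_integrable lborel (disc (1 / p) \<phi>) h" if "integrable lborel h" for h :: "real^2 \<Rightarrow> real"
    using that unfolding set_integrable_def disc_def
    by (intro integrable_mult_indicator) auto
  then show ?thesis unfolding disc_transform1_def using f g by (intro set_integral_diff) auto
qed

text \<open>
  A half-plane with \<open>|\<xi>| / r < c < |\<xi>|\<close> is the inverse of a disc with \<open>p = c / |\<xi>|\<close>, to which the
  hypothesis applies; for \<open>c \<ge> |\<xi>|\<close> it misses the inverted support, which lies inside the
  unit circle.
\<close>

lemma exterior_null_inversion:
  assumes r: "r > 1" and int: "integrable lborel h"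
    and supp: "\<And>x. h x \<noteq> 0 \<Longrightarrow> 1 < norm x"
    and null: "\<And>p \<phi>. 1 / r < p \<Longrightarrow> p < 1 \<Longrightarrow> 0 \<le> \<phi> \<Longrightarrow> \<phi> \<le> 2 * pi \<Longrightarrow> disc_transform1 h p \<phi> = 0"
  shows "exterior_null lborel h inversion 1 (1 / r)"
proof
  show "integrable lborel h" by fact
  show "inversion \<in> borel_measurable lborel" using measurable_inversion by simp
  show Y: "norm (inversion x) \<le> 1" if "h x \<noteq> 0" for x
    unfolding norm_inversion using supp[OF that] by (simp add: inverse_le_1_iff)
  show "(\<integral>x. indicator {x. c \<le> \<xi> \<bullet> inversion x} x * h x \<partial>lborel) = 0"
    if c: "1 / r * norm \<xi> < c" for \<xi> :: "real^2" and c
  proof (cases "norm \<xi> \<le> c")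
    case True
    have "indicator {x. c \<le> \<xi> \<bullet> inversion x} x * h x = 0" for x
    proof (cases "h x = 0")
      case False
      then have x: "1 < norm x" by (rule supp)
      have c0: "0 < c" using c r by (smt (verit) divide_nonneg_pos mult_nonneg_nonneg norm_ge_zero)
      have "\<xi> \<bullet> inversion x \<le> norm \<xi> * norm (inversion x)" by (rule norm_cauchy_schwarz)
      also have "\<dots> \<le> c * inverse (norm x)"
        unfolding norm_inversion using True by (intro mult_right_mono) auto
      also have "\<dots> < c * 1"
        using x c0 by (intro mult_strict_left_mono) (auto intro: inverse_less_1_iff[THEN iffD2])
      finally have "\<xi> \<bullet> inversion x < c" by simp
      then show ?thesis by simp
    qed simp
    then show ?thesis by (simp only: Bochner_Integration.integral_zero)
  next
    case False
    then have \<xi>: "norm \<xi> > 0" using c r by (smt (verit) divide_nonneg_pos mult_nonneg_nonneg norm_ge_zero)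
    define p where "p = c / norm \<xi>"
    have p: "1 / r < p" "p < 1" using c False \<xi> unfolding p_def by (auto simp: field_simps)
    have p0: "p > 0" using p r by (smt (verit) divide_pos_pos)
    define e where "e = \<xi> /\<^sub>R norm \<xi>"
    have "norm e = 1" using \<xi> unfolding e_def by simp
    then have "(e $ 1)\<^sup>2 + (e $ 2)\<^sup>2 = 1"
      by (simp add: norm_vec_def L2_set_def sum_2)
    then obtain \<phi> where \<phi>: "0 \<le> \<phi>" "\<phi> < 2 * pi" "e $ 1 = cos \<phi>" "e $ 2 = sin \<phi>"
      by (rule sincos_total_2pi)
    then have e: "polar 1 \<phi> = e" by (simp add: polar_def vec_eq_iff forall_2)
    have "indicator {x. c \<le> \<xi> \<bullet> inversion x} x * h x = indicator (disc (1 / p) \<phi>) x *\<^sub>R h x" for x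
    proof (cases "h x = 0")
      case False
      then have "x \<noteq> 0" using supp[OF False] by auto
      have "c \<le> \<xi> \<bullet> inversion x \<longleftrightarrow> p \<le> e \<bullet> inversion x"
        using \<xi> unfolding p_def e_def by (simp add: field_simps)
      then have "x \<in> disc (1 / p) \<phi> \<longleftrightarrow> c \<le> \<xi> \<bullet> inversion x"
        using mem_disc_iff_inversion[OF p0 \<open>x \<noteq> 0\<close>] e by simp
      then show ?thesis by (simp add: indicator_def)
    qed simp
    then have "(\<integral>x. indicator {x. c \<le> \<xi> \<bullet> inversion x} x * h x \<partial>lborel) = disc_transform1 h p \<phi>"
      unfolding disc_transform1_def set_lebesgue_integral_def by (simp only:)
    then show ?thesis using null p \<phi> by simp
  qed
qed

text \<open>
  If \<open>h z \<noteq> 0\<close>, take the hat functions in the direction of \<open>z\<close> and orthogonal to it, centred at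
  the inverse of \<open>z\<close>. Since the inversion distorts distances within the annulus by at most
  the factor \<open>r\<^sup>2\<close>, hats of small width confine \<open>x\<close> to a neighbourhood of \<open>z\<close> where \<open>h\<close> has constant
  sign. The integral of the product then has an integrand of one sign and cannot vanish.
\<close>

lemma disc_transform1_null_imp_zero:
  assumes r: "r > 1" and cont: "continuous_on UNIV h" and int: "integrable lborel h"
    and supp: "\<And>x. h x \<noteq> 0 \<Longrightarrow> 1 < norm x \<and> norm x < r"
    and null: "\<And>p \<phi>. 1 / r < p \<Longrightarrow> p < 1 \<Longrightarrow> 0 \<le> \<phi> \<Longrightarrow> \<phi> \<le> 2 * pi \<Longrightarrow> disc_transform1 h p \<phi> = 0"
  shows "h z = 0"
proof (rule ccontr)
  assume hz: "h z \<noteq> 0"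
  interpret exterior_null lborel h inversion 1 "1 / r"
    using exterior_null_inversion[OF r int _ null] supp by blast
  have z: "1 < norm z" "norm z < r" using supp[OF hz] by auto
  then have z0: "z \<noteq> 0" by auto
  obtain \<delta> where \<delta>: "\<delta> > 0" "\<And>x. norm (x - z) < \<delta> \<Longrightarrow> \<bar>h x - h z\<bar> < \<bar>h z\<bar>"
    using cont hz unfolding continuous_on_iff by (metis UNIV_I dist_norm real_norm_def zero_less_abs_iff)
  define v where "v = inverse (norm z)"
  define \<xi> where "\<xi> = z /\<^sub>R norm z"
  define \<eta> :: "real^2" where "\<eta> = vector [- \<xi> $ 2, \<xi> $ 1]"
  have \<xi>: "norm \<xi> = 1" unfolding \<xi>_def using z0 by simp
  have v: "1 / r < v" unfolding v_def inverse_eq_divide using z by (intro divide_strict_left_mono mult_pos_pos) auto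
  have vz: "\<xi> \<bullet> inversion z = v"
    unfolding v_def \<xi>_def inversion_def using z0
    by (simp add: dot_square_norm power2_eq_square field_simps)
  have uz: "\<eta> \<bullet> inversion z = 0"
    unfolding \<eta>_def \<xi>_def inversion_def by (simp add: inner_vec_def sum_2)
  \<comment> \<open>The first bound keeps the hat above \<open>1/r\<close>; the second gives \<open>|x - z| < \<delta>\<close> on the support
    of the product of the hats.\<close>
  define t where "t = min ((v - 1 / r) / 2) (\<delta> / (2 * r\<^sup>2))"
  have t: "t > 0" "1 / r < v - t" "2 * t * r\<^sup>2 \<le> \<delta>"
  proof -
    show "t > 0" using v \<delta> r unfolding t_def by simp
    have "t \<le> (v - 1 / r) / 2" unfolding t_def by (rule min.cobounded1)
    also have "\<dots> < v - 1 / r" using half_gt_zero_iff[of "v - 1 / r"] field_less_half_sum v by simp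
    finally show "1 / r < v - t" by (simp only: less_diff_eq add.commute)
    have "t \<le> \<delta> / (2 * r\<^sup>2)" unfolding t_def by (rule min.cobounded2)
    then show "2 * t * r\<^sup>2 \<le> \<delta>" using r by (simp add: field_simps)
  qed
  define hat where "hat s = max 0 (t - \<bar>s\<bar>)" for s :: real
  have hat_cont: "continuous_on UNIV hat" unfolding hat_def by (intro continuous_intros)
  define F where "F x = hat (\<xi> \<bullet> inversion x - v) * hat (\<eta> \<bullet> inversion x) * (h x * h z)" for x
  have F_eq: "F x = (hat (\<xi> \<bullet> inversion x - v) * hat (\<eta> \<bullet> inversion x) * h x) * h z" for x
    unfolding F_def by simp
  have \<psi>: "continuous_on UNIV (\<lambda>s. hat (s - v))"
    unfolding hat_def by (intro continuous_intros)
  have "F z = 0"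
  proof (rule integral_zero_imp_zero_at_continuity_point[of F])
    show "integrable lborel F"
      unfolding F_eq[abs_def]
      by (intro integrable_mult_left integrable_continuous_mult_continuous[OF \<psi> hat_cont])
    have "(\<integral>x. hat (\<xi> \<bullet> inversion x - v) * hat (\<eta> \<bullet> inversion x) * h x \<partial>lborel) = 0"
    proof (rule product_null[of \<xi> "v - t", OF _ \<psi> _ hat_cont])
      show "1 / r * norm \<xi> < v - t" using \<xi> t by simp
      show "hat (s - v) = 0" if "s \<le> v - t" for s using that unfolding hat_def by simp
    qed
    then show "(\<integral>x. F x \<partial>lborel) = 0"
      unfolding F_eq[abs_def] by simp
    show "0 \<le> F x" for x
    proof (rule ccontr)
      assume neg: "\<not> 0 \<le> F x"
      have hat0: "hat s \<ge> 0" for s unfolding hat_def by simp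
      have hx: "h x * h z < 0"
        using neg hat0 unfolding F_def by (metis mult_nonneg_nonneg not_le)
      then have "h x \<noteq> 0" by auto
      then have x: "1 < norm x" "norm x < r" using supp by auto
      then have x0: "x \<noteq> 0" by auto
      define d where "d = inversion x - inversion z"
      have "hat (\<xi> \<bullet> inversion x - v) \<noteq> 0" "hat (\<eta> \<bullet> inversion x) \<noteq> 0"
        using neg unfolding F_def by auto
      then have "\<bar>\<xi> \<bullet> d\<bar> < t" "\<bar>\<eta> \<bullet> d\<bar> < t"
        unfolding hat_def d_def inner_diff_right vz uz by (auto split: if_splits simp: max_def)
      then have "\<bar>\<xi> \<bullet> d\<bar> + \<bar>\<eta> \<bullet> d\<bar> < 2 * t" by simp
      moreover have "norm d \<le> \<bar>\<xi> \<bullet> d\<bar> + \<bar>\<eta> \<bullet> d\<bar>"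
      proof (rule power2_le_imp_le)
        have n: "(\<xi> $ 1)\<^sup>2 + (\<xi> $ 2)\<^sup>2 = 1" using \<xi> by (simp add: norm_vec_def L2_set_def sum_2)
        have "(norm d)\<^sup>2 = (d $ 1)\<^sup>2 + (d $ 2)\<^sup>2"
          by (simp add: norm_vec_def L2_set_def sum_2)
        also have "\<dots> = ((\<xi> $ 1)\<^sup>2 + (\<xi> $ 2)\<^sup>2) * ((d $ 1)\<^sup>2 + (d $ 2)\<^sup>2)" using n by simp
        also have "\<dots> = (\<xi> \<bullet> d)\<^sup>2 + (\<eta> \<bullet> d)\<^sup>2"
          unfolding \<eta>_def by (simp add: inner_vec_def sum_2 power2_eq_square algebra_simps)
        also have "\<dots> \<le> (\<bar>\<xi> \<bullet> d\<bar> + \<bar>\<eta> \<bullet> d\<bar>)\<^sup>2" by (simp add: power2_sum)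
        finally show "(norm d)\<^sup>2 \<le> (\<bar>\<xi> \<bullet> d\<bar> + \<bar>\<eta> \<bullet> d\<bar>)\<^sup>2" .
      qed simp
      ultimately have d: "norm d < 2 * t" by linarith
      have "norm (x - z) = norm d * (norm x * norm z)"
        unfolding d_def norm_diff_inversion[OF x0 z0] using x0 z0 by simp
      also have "\<dots> \<le> norm d * (r * r)"
        using x z by (intro mult_left_mono mult_mono) auto
      also have "\<dots> < 2 * t * (r * r)"
        using d r by (intro mult_strict_right_mono) auto
      also have "\<dots> \<le> \<delta>" using t(3) by (simp add: power2_eq_square)
      finally have "\<bar>h x - h z\<bar> < \<bar>h z\<bar>" by (rule \<delta>(2))
      then have "0 < h x * h z" by (auto simp: zero_less_mult_iff)
      then show False using hx by simp
    qed
    show "isCont F z"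
    proof -
      have "isCont h z" using cont by (simp add: continuous_on_eq_continuous_at)
      then show ?thesis
        unfolding F_def hat_def by (intro continuous_intros isCont_inversion z0)
    qed
  qed
  moreover have "F z = t * t * (h z * h z)"
    unfolding F_def vz uz hat_def using t by simp
  ultimately show False using t hz by simp
qed

theorem corollary1:
  fixes r :: real and f1 f2 :: "real^2 \<Rightarrow> real"
  assumes "r > 1"
    and "f1 \<in> C0_infty (annulus 1 r)"
    and "f2 \<in> C0_infty (annulus 1 r)"
    and "\<forall>(p, \<phi>) \<in> Z_restr r. disc_transform f1 p \<phi> = disc_transform f2 p \<phi>"
  shows "f1 = f2"
proof
  fix z
  define h where "h x = f1 x - f2 x" for x
  note int = C0_infty_annulus_integrable[OF assms(2)] C0_infty_annulus_integrable[OF assms(3)]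
  note cont = C0_infty_imp_continuous[OF open_annulus assms(2)]
    C0_infty_imp_continuous[OF open_annulus assms(3)]
  have "h z = 0"
  proof (rule disc_transform1_null_imp_zero[OF assms(1)])
    show "continuous_on UNIV h" unfolding h_def by (intro continuous_intros cont)
    show "integrable lborel h" unfolding h_def using int by simp
    show "1 < norm x \<and> norm x < r" if "h x \<noteq> 0" for x
    proof -
      have "f1 x \<noteq> 0 \<or> f2 x \<noteq> 0" using that unfolding h_def by auto
      then show ?thesis
        using C0_infty_annulus_support[OF assms(2)] C0_infty_annulus_support[OF assms(3)] by blast
    qed
    show "disc_transform1 h p \<phi> = 0" if "1 / r < p" "p < 1" "0 \<le> \<phi>" "\<phi> \<le> 2 * pi" for p \<phi>
    proof -
      have "disc_transform f1 q \<phi> = disc_transform f2 q \<phi>" if "1 / r < q" "q < 1" for q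
        using assms(4) that \<open>0 \<le> \<phi>\<close> \<open>\<phi> \<le> 2 * pi\<close> unfolding Z_restr_def by auto
      then have "disc_transform1 f1 p \<phi> = disc_transform1 f2 p \<phi>"
        using disc_transform_eq_imp_disc_transform1_eq[OF assms(1-3)] that by blast
      then show ?thesis unfolding h_def disc_transform1_diff[OF int] by simp
    qed
  qed
  then show "f1 z = f2 z" unfolding h_def by simp
qed

end
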